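(* Let $G$ be a finite group, let $V$ and $W$ be finite-dimensional complex vector spaces, let $\Phi_1:\mathcal{L}(G)\to\mathfrak{gl}(V)$ be an $\alpha_1$-representation and let $\Phi_2:\mathcal{L}(G)\to\mathfrak{gl}(W)$ be an $\alpha_2$-representation of $\mathcal{L}(G)$. If $\Phi_1$ is projectively equivalent to $\Phi_2$, then $\alpha_1$ and $\alpha_2$ are cohomologous.
   Context: For a finite group $G$, the Plesken Lie algebra $\mathcal{L}(G)$ over $\mathbb{C}$ is the linear span of the elements $\hat g = g - g^{-1}$ ($g\in G$) in the group algebra $\mathbb{C}[G]$, with Lie bracket the commutator $[x,y]=xy-yx$. Let $V$ be a finite-dimensional complex vector space, $\mathfrak{gl}(V)$ the Lie algebra of linear endomorphisms of $V$ with the commutator bracket, $I_V$ the identity map of $V$, and $\alpha:\mathcal{L}(G)\times\mathcal{L}(G)\to\mathbb{C}$ a bilinear map. An $\alpha$-representation of $\mathcal{L}(G)$ on $V$ (a projective representation with associated bilinear map $\alpha$) is a linear map $\Phi:\mathcal{L}(G)\to\mathfrak{gl}(V)$ such that $[\Phi(x),\Phi(y)]=\alpha(x,y)I_V+\Phi([x,y])$ for all $x,y\in\mathcal{L}(G)$. The map $\alpha$ is regarded as a 2-cocycle, meaning a bilinear map with $\alpha([x,y],z)+\alpha([y,z],x)+\alpha([z,x],y)=0$ for all $x,y,z\in\mathcal{L}(G)$; the Jacobi identities in $\mathfrak{gl}(V)$ and $\mathcal{L}(G)$ give this identity multiplied by $I_V$. An $\alpha_1$-representation $\Phi_1$ on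 $V$ and an $\alpha_2$-representation $\Phi_2$ on $W$ are projectively equivalent if there exist a linear isomorphism $f:V\to W$ and a linear map $\delta:\mathcal{L}(G)\to\mathbb{C}$ such that $\Phi_2(x)=f\circ\Phi_1(x)\circ f^{-1}+\delta(x)I_W$ for all $x\in\mathcal{L}(G)$. Two 2-cocycles $\alpha_1,\alpha_2$ are cohomologous if there exists a linear map $\sigma:\mathcal{L}(G)\to\mathbb{C}$ such that $\alpha_2(x,y)-\alpha_1(x,y)=-\sigma([x,y])$ for all $x,y\in\mathcal{L}(G)$.
   Formalization: V is assumed nonzero (hence so is W); for V = W = 0 the claim fails, e.g. G = C_5, where L(G) is abelian of dimension 2, with α_1 = 0 and α_2 a nonzero alternating form. *)

theory Defs
  imports Complex_Main "HOL-Library.Function_Algebras" "HOL-Algebra.Group"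
begin

text \<open>
  An element of the group algebra is its coefficient function \<open>'g \<Rightarrow> complex\<close>,
  which vanishes outside \<open>carrier G\<close>; addition is pointwise
  (\<open>HOL-Library.Function_Algebras\<close>). The pointwise product \<open>*\<close> from that theory is
  not the product of the group algebra and is never used for it.
\<close>

definition ga_scale :: "complex \<Rightarrow> ('g \<Rightarrow> complex) \<Rightarrow> 'g \<Rightarrow> complex" where
  "ga_scale c a = (\<lambda>x. c * a x)"

definition ga_elem :: "'g \<Rightarrow> 'g \<Rightarrow> complex" where
  "ga_elem g = (\<lambda>x. if x = g then 1 else 0)"

definition ga_mult ::
  "('g, 'm) monoid_scheme \<Rightarrow> ('g \<Rightarrow> complex) \<Rightarrow> ('g \<Rightarrow> complex) \<Rightarrow> 'g \<Rightarrow> complex" where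
  "ga_mult G a b =
     (\<Sum>g\<in>carrier G. \<Sum>h\<in>carrier G. ga_scale (a g * b h) (ga_elem (g \<otimes>\<^bsub>G\<^esub> h)))"

definition ga_bracket ::
  "('g, 'm) monoid_scheme \<Rightarrow> ('g \<Rightarrow> complex) \<Rightarrow> ('g \<Rightarrow> complex) \<Rightarrow> 'g \<Rightarrow> complex" where
  "ga_bracket G a b = ga_mult G a b - ga_mult G b a"

definition plesken :: "('g, 'm) monoid_scheme \<Rightarrow> ('g \<Rightarrow> complex) set" where
  "plesken G = module.span ga_scale {ga_elem g - ga_elem (inv\<^bsub>G\<^esub> g) | g. g \<in> carrier G}"

text \<open>
  Maps on the Plesken Lie algebra are total functions on \<open>'g \<Rightarrow> complex\<close> of which only the
  values on \<open>plesken G\<close> matter, so linearity is relative to that subspace; \<open>s\<close> is the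
  scalar multiplication of the codomain.
\<close>

definition plesken_linear ::
  "('g, 'm) monoid_scheme \<Rightarrow> (complex \<Rightarrow> 'v::ab_group_add \<Rightarrow> 'v) \<Rightarrow> (('g \<Rightarrow> complex) \<Rightarrow> 'v) \<Rightarrow> bool"
where
  "plesken_linear G s f \<longleftrightarrow>
     (\<forall>x\<in>plesken G. \<forall>y\<in>plesken G. f (x + y) = f x + f y) \<and>
     (\<forall>c. \<forall>x\<in>plesken G. f (ga_scale c x) = s c (f x))"

definition plesken_bilinear ::
  "('g, 'm) monoid_scheme \<Rightarrow> (('g \<Rightarrow> complex) \<Rightarrow> ('g \<Rightarrow> complex) \<Rightarrow> complex) \<Rightarrow> bool" where
  "plesken_bilinear G \<alpha> \<longleftrightarrow>
     (\<forall>x\<in>plesken G. plesken_linear G (*) (\<lambda>y. \<alpha> x y)) \<and>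
     (\<forall>y\<in>plesken G. plesken_linear G (*) (\<lambda>x. \<alpha> x y))"

definition two_cocycle ::
  "('g, 'm) monoid_scheme \<Rightarrow> (('g \<Rightarrow> complex) \<Rightarrow> ('g \<Rightarrow> complex) \<Rightarrow> complex) \<Rightarrow> bool" where
  "two_cocycle G \<alpha> \<longleftrightarrow> plesken_bilinear G \<alpha> \<and>
     (\<forall>x\<in>plesken G. \<forall>y\<in>plesken G. \<forall>z\<in>plesken G.
        \<alpha> (ga_bracket G x y) z + \<alpha> (ga_bracket G y z) x + \<alpha> (ga_bracket G z x) y = 0)"

definition cohomologous ::
  "('g, 'm) monoid_scheme \<Rightarrow> (('g \<Rightarrow> complex) \<Rightarrow> ('g \<Rightarrow> complex) \<Rightarrow> complex)
    \<Rightarrow> (('g \<Rightarrow> complex) \<Rightarrow> ('g \<Rightarrow> complex) \<Rightarrow> complex) \<Rightarrow> bool" where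
  "cohomologous G \<alpha>\<^sub>1 \<alpha>\<^sub>2 \<longleftrightarrow> two_cocycle G \<alpha>\<^sub>1 \<and> two_cocycle G \<alpha>\<^sub>2 \<and>
     (\<exists>\<sigma>. plesken_linear G (*) \<sigma> \<and>
        (\<forall>x\<in>plesken G. \<forall>y\<in>plesken G. \<alpha>\<^sub>2 x y - \<alpha>\<^sub>1 x y = - \<sigma> (ga_bracket G x y)))"

text \<open>
  A vector space is a whole type with scalar multiplication \<open>s\<close>. Endomorphisms are added
  pointwise, and the scalar multiple of \<open>A\<close> by \<open>c\<close> is \<open>\<lambda>v. s c (A v)\<close>.
\<close>

definition gl_bracket :: "('v::ab_group_add \<Rightarrow> 'v) \<Rightarrow> ('v \<Rightarrow> 'v) \<Rightarrow> 'v \<Rightarrow> 'v" where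
  "gl_bracket A B = (A \<circ> B) - (B \<circ> A)"

text \<open>
  Only bilinearity of \<open>\<alpha>\<close> is required here: on a nonzero space the cocycle identity follows
  from the Jacobi identities.
\<close>

definition projective_rep ::
  "('g, 'm) monoid_scheme \<Rightarrow> (complex \<Rightarrow> 'v::ab_group_add \<Rightarrow> 'v)
    \<Rightarrow> (('g \<Rightarrow> complex) \<Rightarrow> ('g \<Rightarrow> complex) \<Rightarrow> complex) \<Rightarrow> (('g \<Rightarrow> complex) \<Rightarrow> 'v \<Rightarrow> 'v) \<Rightarrow> bool" where
  "projective_rep G s \<alpha> \<Phi> \<longleftrightarrow>
     plesken_bilinear G \<alpha> \<and>
     (\<forall>x\<in>plesken G. Vector_Spaces.linear s s (\<Phi> x)) \<and>
     plesken_linear G (\<lambda>c A v. s c (A v)) \<Phi> \<and>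
     (\<forall>x\<in>plesken G. \<forall>y\<in>plesken G.
        gl_bracket (\<Phi> x) (\<Phi> y) = (\<lambda>v. s (\<alpha> x y) v) + \<Phi> (ga_bracket G x y))"

definition projectively_equivalent ::
  "('g, 'm) monoid_scheme \<Rightarrow> (complex \<Rightarrow> 'v::ab_group_add \<Rightarrow> 'v) \<Rightarrow> (complex \<Rightarrow> 'w::ab_group_add \<Rightarrow> 'w)
    \<Rightarrow> (('g \<Rightarrow> complex) \<Rightarrow> 'v \<Rightarrow> 'v) \<Rightarrow> (('g \<Rightarrow> complex) \<Rightarrow> 'w \<Rightarrow> 'w) \<Rightarrow> bool" where
  "projectively_equivalent G sV sW \<Phi>\<^sub>1 \<Phi>\<^sub>2 \<longleftrightarrow>
     (\<exists>f \<delta>. Vector_Spaces.linear sV sW f \<and> bij f \<and> plesken_linear G (*) \<delta> \<and>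
        (\<forall>x\<in>plesken G. \<Phi>\<^sub>2 x = (f \<circ> \<Phi>\<^sub>1 x \<circ> inv_into UNIV f) + (\<lambda>w. sW (\<delta> x) w)))"

end

theory Submission
  imports Defs
begin

text \<open>
  Conjugating by \<open>f\<close> and adding the scalar \<open>\<delta> x\<close> does not change the commutator of two
  operators except through \<open>\<Phi>\<^sub>2 (ga_bracket G x y)\<close>, which carries the extra scalar
  \<open>\<delta> (ga_bracket G x y)\<close>; comparing scalars on a nonzero vector shows that \<open>\<delta>\<close> itself is
  the required \<open>\<sigma>\<close>. The cocycle identities come from the Jacobi identities. For
  these one needs that \<open>plesken G\<close> is closed under the bracket, which is seen by identifying
  it with the \<open>-1\<close>-eigenspace of the anti-automorphism \<open>g \<mapsto> g\<inverse>\<close> of the group algebra.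
\<close>

section \<open>The group algebra: product, associativity and Jacobi identity\<close>

lemma vector_space_ga_scale: "vector_space ga_scale"
  by unfold_locales (auto simp: ga_scale_def fun_eq_iff algebra_simps)

lemma sum_fun_apply: "(\<Sum>i\<in>A. F i) x = (\<Sum>i\<in>A. F i x)"
  for F :: "'i \<Rightarrow> 'a \<Rightarrow> 'b::comm_monoid_add"
  by (induction A rule: infinite_finite_induct) auto

lemma ga_mult_apply:
  "ga_mult G a b x =
     (\<Sum>g\<in>carrier G. \<Sum>h\<in>carrier G. a g * b h * (if x = g \<otimes>\<^bsub>G\<^esub> h then 1 else 0))"
  by (simp add: ga_mult_def ga_scale_def ga_elem_def sum_fun_apply)

lemma ga_mult_diff_left: "ga_mult G (a - b) c = ga_mult G a c - ga_mult G b c"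
  by (rule ext) (simp add: ga_mult_apply algebra_simps sum_subtractf)

lemma ga_mult_diff_right: "ga_mult G c (a - b) = ga_mult G c a - ga_mult G c b"
  by (rule ext) (simp add: ga_mult_apply algebra_simps sum_subtractf)

context group
begin

text \<open>Since \<open>g \<otimes> h\<close> stays in the carrier, exactly one \<open>u\<close>
  contributes for each pair. With \<open>F\<close> arbitrary, this evaluates the linear extension of
  \<open>F\<close> at a product, which is how nested products are removed below.\<close>

lemma sum_ga_mult:
  assumes "finite (carrier G)"
  shows "(\<Sum>u\<in>carrier G. ga_mult G a b u * F u) =
    (\<Sum>g\<in>carrier G. \<Sum>h\<in>carrier G. a g * b h * F (g \<otimes> h))"
proof -
  have "(\<Sum>u\<in>carrier G. ga_mult G a b u * F u) =
    (\<Sum>u\<in>carrier G. \<Sum>g\<in>carrier G. \<Sum>h\<in>carrier G.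
       a g * b h * (if u = g \<otimes> h then 1 else 0) * F u)"
    by (simp add: ga_mult_apply sum_distrib_right)
  also have "\<dots> = (\<Sum>g\<in>carrier G. \<Sum>u\<in>carrier G. \<Sum>h\<in>carrier G.
       a g * b h * (if u = g \<otimes> h then 1 else 0) * F u)"
    by (rule sum.swap)
  also have "\<dots> = (\<Sum>g\<in>carrier G. \<Sum>h\<in>carrier G. \<Sum>u\<in>carrier G.
       a g * b h * (if u = g \<otimes> h then 1 else 0) * F u)"
    by (intro sum.cong refl sum.swap)
  also have "\<dots> = (\<Sum>g\<in>carrier G. \<Sum>h\<in>carrier G. a g * b h * F (g \<otimes> h))"
  proof (intro sum.cong refl)
    fix g h assume "g \<in> carrier G" "h \<in> carrier G"
    then have "g \<otimes> h \<in> carrier G" by simp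
    have "(\<Sum>u\<in>carrier G. a g * b h * (if u = g \<otimes> h then 1 else 0) * F u) =
      (\<Sum>u\<in>carrier G. if u = g \<otimes> h then a g * b h * F u else 0)"
      by (intro sum.cong refl) simp
    then show "(\<Sum>u\<in>carrier G. a g * b h * (if u = g \<otimes> h then 1 else 0) * F u) =
      a g * b h * F (g \<otimes> h)"
      using assms \<open>g \<otimes> h \<in> carrier G\<close> by (simp add: sum.delta)
  qed
  finally show ?thesis .
qed

text \<open>\<open>sum_ga_mult\<close> expands the inner product on each side into the same triple
  sum, leaving associativity in the group. Arbitrary functions are allowed because
  \<open>ga_mult\<close> reads coefficients on the carrier only.\<close>

lemma ga_mult_assoc:
  assumes "finite (carrier G)"
  shows "ga_mult G (ga_mult G a b) c = ga_mult G a (ga_mult G b c)"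
proof
  fix x
  have "ga_mult G (ga_mult G a b) c x = (\<Sum>u\<in>carrier G. ga_mult G a b u *
      (\<Sum>k\<in>carrier G. c k * (if x = u \<otimes> k then 1 else 0)))"
    by (subst ga_mult_apply) (simp add: sum_distrib_left mult.assoc)
  also have "\<dots> = (\<Sum>g\<in>carrier G. \<Sum>h\<in>carrier G. a g * b h *
      (\<Sum>k\<in>carrier G. c k * (if x = g \<otimes> h \<otimes> k then 1 else 0)))"
    by (rule sum_ga_mult[OF assms])
  also have "\<dots> = (\<Sum>g\<in>carrier G. a g * (\<Sum>h\<in>carrier G. \<Sum>k\<in>carrier G. b h * c k *
      (if x = g \<otimes> (h \<otimes> k) then 1 else 0)))"
    by (simp add: sum_distrib_left mult.assoc m_assoc cong: sum.cong)
  also have "\<dots> = (\<Sum>g\<in>carrier G. a g * (\<Sum>u\<in>carrier G. ga_mult G b c u *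
      (if x = g \<otimes> u then 1 else 0)))"
    by (simp only: sum_ga_mult[OF assms])
  also have "\<dots> = ga_mult G a (ga_mult G b c) x"
    by (subst (2) ga_mult_apply) (simp only: sum_distrib_left mult.assoc)
  finally show "ga_mult G (ga_mult G a b) c x = ga_mult G a (ga_mult G b c) x" .
qed

lemma ga_bracket_jacobi:
  assumes "finite (carrier G)"
  shows "ga_bracket G (ga_bracket G x y) z + ga_bracket G (ga_bracket G y z) x
    + ga_bracket G (ga_bracket G z x) y = 0"
  by (simp add: ga_bracket_def ga_mult_diff_left ga_mult_diff_right ga_mult_assoc[OF assms])

section \<open>The Plesken Lie algebra as a Lie subalgebra\<close>

lemma sum_inv_reindex: "(\<Sum>g\<in>carrier G. F (inv g)) = (\<Sum>g\<in>carrier G. F g)"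
  by (rule sum.reindex_bij_witness[of _ "\<lambda>g. inv g" "\<lambda>g. inv g"]) auto

lemma ga_mult_outside: "x \<notin> carrier G \<Longrightarrow> ga_mult G a b x = 0"
  by (auto simp: ga_mult_apply intro!: sum.neutral)

text \<open>This replaces membership in a span by a pointwise test. The generators pass the test and
  it is linear; conversely, an antisymmetric function is an explicit combination of the
  generators.\<close>

lemma plesken_eq:
  assumes "finite (carrier G)"
  shows "plesken G = {a. (\<forall>x. x \<notin> carrier G \<longrightarrow> a x = 0) \<and> (\<forall>x\<in>carrier G. a (inv x) = - a x)}"
    (is "_ = ?A")
proof
  interpret vs: vector_space ga_scale by (rule vector_space_ga_scale)
  have "vs.subspace ?A"
    by (auto simp: vs.subspace_def ga_scale_def)
  moreover have "{ga_elem g - ga_elem (inv g) | g. g \<in> carrier G} \<subseteq> ?A"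
    by (auto simp: ga_elem_def) (metis inv_inv)+
  ultimately show "plesken G \<subseteq> ?A"
    unfolding plesken_def by (intro vs.span_minimal)
  show "?A \<subseteq> plesken G"
  proof
    fix a assume a: "a \<in> ?A"
    have delta: "(\<Sum>g\<in>carrier G. b g * ga_elem g x) = b x" if "\<And>x. x \<notin> carrier G \<Longrightarrow> b x = 0" for b x
    proof -
      have "(\<Sum>g\<in>carrier G. b g * ga_elem g x) = (\<Sum>g\<in>carrier G. if g = x then b g else 0)"
        by (intro sum.cong refl) (simp add: ga_elem_def)
      then show ?thesis using assms that by (simp add: sum.delta)
    qed
    \<comment> \<open>The factor 1/2 compensates for double counting: after reindexing by inversion,
      antisymmetry makes the \<open>inv g\<close> terms contribute another copy of
      \<open>a\<close>.\<close>
    have "a = (\<Sum>g\<in>carrier G. ga_scale (a g / 2) (ga_elem g - ga_elem (inv g)))"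
    proof
      fix x
      have "(\<Sum>g\<in>carrier G. a g * ga_elem (inv g) x) = (\<Sum>g\<in>carrier G. a (inv g) * ga_elem g x)"
        by (subst sum_inv_reindex[symmetric]) (simp cong: sum.cong)
      also have "\<dots> = - (\<Sum>g\<in>carrier G. a g * ga_elem g x)"
        using a by (simp add: sum_negf cong: sum.cong)
      finally have "(\<Sum>g\<in>carrier G. a g * ga_elem g x - a g * ga_elem (inv g) x) = 2 * a x"
        using a delta[of a x] by (simp add: sum_subtractf)
      moreover have "(\<Sum>g\<in>carrier G. ga_scale (a g / 2) (ga_elem g - ga_elem (inv g))) x =
          (\<Sum>g\<in>carrier G. a g * ga_elem g x - a g * ga_elem (inv g) x) / 2"
        unfolding sum_fun_apply sum_divide_distrib
        by (intro sum.cong refl) (simp add: ga_scale_def field_simps)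
      ultimately show "a x = (\<Sum>g\<in>carrier G. ga_scale (a g / 2) (ga_elem g - ga_elem (inv g))) x"
        by simp
    qed
    also have "\<dots> \<in> plesken G"
      unfolding plesken_def by (intro vs.span_sum vs.span_scale vs.span_base) blast
    finally show "a \<in> plesken G" .
  qed
qed

text \<open>Inversion reverses products, and the signs coming from the antisymmetry of
  \<open>a\<close> and of \<open>b\<close> cancel. Hence inversion exchanges the two halves of the
  commutator and negates it.\<close>

lemma ga_mult_plesken_inv:
  assumes "finite (carrier G)" and a: "a \<in> plesken G" and b: "b \<in> plesken G"
    and x: "x \<in> carrier G"
  shows "ga_mult G a b (inv x) = ga_mult G b a x"
proof -
  have "ga_mult G a b (inv x) = (\<Sum>g\<in>carrier G. \<Sum>h\<in>carrier G.
      a (inv g) * b (inv h) * (if inv x = inv g \<otimes> inv h then 1 else 0))"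
    unfolding ga_mult_apply
    by (simp only: sum_inv_reindex[of "\<lambda>h. a g * b h * (if inv x = g \<otimes> h then 1 else 0)" for g]
      sum_inv_reindex[of "\<lambda>g. \<Sum>h\<in>carrier G. a g * b h * (if inv x = g \<otimes> h then 1 else 0)"])
  also have "\<dots> = (\<Sum>g\<in>carrier G. \<Sum>h\<in>carrier G. b h * a g * (if x = h \<otimes> g then 1 else 0))"
  proof (intro sum.cong refl)
    fix g h assume gh: "g \<in> carrier G" "h \<in> carrier G"
    then have "inv x = inv g \<otimes> inv h \<longleftrightarrow> x = h \<otimes> g"
      using x by (metis inv_mult_group inv_inv m_closed)
    then show "a (inv g) * b (inv h) * (if inv x = inv g \<otimes> inv h then 1 else 0) =
        b h * a g * (if x = h \<otimes> g then 1 else 0)"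
      using a b gh by (simp add: plesken_eq[OF assms(1)])
  qed
  also have "\<dots> = ga_mult G b a x"
    unfolding ga_mult_apply by (rule sum.swap)
  finally show ?thesis .
qed

lemma ga_bracket_closed:
  assumes "finite (carrier G)" "a \<in> plesken G" "b \<in> plesken G"
  shows "ga_bracket G a b \<in> plesken G"
  by (subst plesken_eq[OF assms(1)])
    (simp add: ga_bracket_def ga_mult_outside ga_mult_plesken_inv assms)

end

section \<open>The cocycle identity for projective representations\<close>

lemma gl_bracket_apply: "gl_bracket A B v = A (B v) - B (A v)"
  by (simp add: gl_bracket_def)

text \<open>The Jacobi identities give the cocycle identity times the identity map; the nonzero
  vector \<open>v\<close> allows the scalar to be read off.\<close>

lemma two_cocycle_projective_rep:
  fixes s :: "complex \<Rightarrow> 'v::ab_group_add \<Rightarrow> 'v"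
  assumes "group G" "finite (carrier G)" and "vector_space s" and "(v::'v) \<noteq> 0"
    and rep: "projective_rep G s \<alpha> \<Phi>"
  shows "two_cocycle G \<alpha>"
proof -
  interpret group G by fact
  interpret vector_space s by fact
  note closed = ga_bracket_closed[OF assms(2)]
  have lin: "Vector_Spaces.linear s s (\<Phi> x)" if "x \<in> plesken G" for x
    using rep that by (simp add: projective_rep_def)
  have add: "\<Phi> (x + y) = \<Phi> x + \<Phi> y" if "x \<in> plesken G" "y \<in> plesken G" for x y
    using rep that by (simp add: projective_rep_def plesken_linear_def)
  have brk: "gl_bracket (\<Phi> x) (\<Phi> y) w = s (\<alpha> x y) w + \<Phi> (ga_bracket G x y) w"
    if "x \<in> plesken G" "y \<in> plesken G" for x y w
    using rep that by (simp add: projective_rep_def)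
  have \<Phi>_brk: "\<Phi> (ga_bracket G x y) w = \<Phi> x (\<Phi> y w) - \<Phi> y (\<Phi> x w) - s (\<alpha> x y) w"
    if "x \<in> plesken G" "y \<in> plesken G" for x y w
    using brk[OF that, of w] by (simp add: gl_bracket_apply algebra_simps)
  have lin_diff: "\<Phi> x (u - w) = \<Phi> x u - \<Phi> x w" if "x \<in> plesken G" for x u w
    using lin[OF that] by (simp add: linear_iff_module_hom module_hom.diff)
  have lin_scale: "\<Phi> x (s c w) = s c (\<Phi> x w)" if "x \<in> plesken G" for x c w
    using lin[OF that] by (simp add: linear_iff_module_hom module_hom.scale)
  \<comment> \<open>The scalar part of \<open>\<Phi> (ga_bracket G x y)\<close> commutes with
    \<open>\<Phi> z\<close>, so only triple products of operators remain.\<close>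
  have \<alpha>3: "s (\<alpha> (ga_bracket G x y) z) v =
      (\<Phi> x (\<Phi> y (\<Phi> z v)) - \<Phi> y (\<Phi> x (\<Phi> z v)) - \<Phi> z (\<Phi> x (\<Phi> y v)) + \<Phi> z (\<Phi> y (\<Phi> x v)))
      - \<Phi> (ga_bracket G (ga_bracket G x y) z) v"
    if "x \<in> plesken G" "y \<in> plesken G" "z \<in> plesken G" for x y z
  proof -
    have "s (\<alpha> (ga_bracket G x y) z) v =
        \<Phi> (ga_bracket G x y) (\<Phi> z v) - \<Phi> z (\<Phi> (ga_bracket G x y) v)
        - \<Phi> (ga_bracket G (ga_bracket G x y) z) v"
      using brk[OF closed[OF that(1,2)] that(3), of v]
      unfolding gl_bracket_apply by (simp only: add_diff_cancel_right')
    also have "\<Phi> (ga_bracket G x y) (\<Phi> z v) - \<Phi> z (\<Phi> (ga_bracket G x y) v) =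
        \<Phi> x (\<Phi> y (\<Phi> z v)) - \<Phi> y (\<Phi> x (\<Phi> z v)) - \<Phi> z (\<Phi> x (\<Phi> y v)) + \<Phi> z (\<Phi> y (\<Phi> x v))"
      unfolding \<Phi>_brk[OF that(1,2)] lin_diff[OF that(3)] lin_scale[OF that(3)]
      by (simp add: algebra_simps)
    finally show ?thesis .
  qed
  have "\<alpha> (ga_bracket G x y) z + \<alpha> (ga_bracket G y z) x + \<alpha> (ga_bracket G z x) y = 0"
    if xyz: "x \<in> plesken G" "y \<in> plesken G" "z \<in> plesken G" for x y z
  proof -
    interpret vs: vector_space ga_scale by (rule vector_space_ga_scale)
    let ?a = "ga_bracket G (ga_bracket G x y) z" and ?b = "ga_bracket G (ga_bracket G y z) x"
      and ?c = "ga_bracket G (ga_bracket G z x) y"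
    \<comment> \<open>Additivity of \<open>\<Phi>\<close> is available only on
      \<open>plesken G\<close>, so the partial sum \<open>?a + ?b\<close> must be shown to lie there
      too.\<close>
    have mem: "?a \<in> plesken G" "?b \<in> plesken G" "?c \<in> plesken G" "?a + ?b \<in> plesken G"
      using closed xyz by (auto simp: plesken_def intro!: vs.span_add)
    have "0 \<in> plesken G" by (simp add: plesken_def vs.span_zero)
    from add[OF this this] have "\<Phi> 0 = 0" by simp
    moreover have "\<Phi> (?a + ?b + ?c) = \<Phi> ?a + \<Phi> ?b + \<Phi> ?c"
      by (simp only: add[OF mem(1,2)] add[OF mem(4,3)])
    ultimately have "\<Phi> ?a + \<Phi> ?b + \<Phi> ?c = 0"
      by (simp only: ga_bracket_jacobi[OF assms(2)])
    from fun_cong[OF this, of v] have \<Phi>_jacobi: "\<Phi> ?a v + \<Phi> ?b v + \<Phi> ?c v = 0"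
      by (simp only: plus_fun_apply zero_fun_apply)
    \<comment> \<open>Over the three cyclic rotations the twelve triple products cancel in pairs:
      the Jacobi identity for endomorphisms.\<close>
    have "s (\<alpha> (ga_bracket G x y) z + \<alpha> (ga_bracket G y z) x + \<alpha> (ga_bracket G z x) y) v
        = - (\<Phi> ?a v + \<Phi> ?b v + \<Phi> ?c v)"
      unfolding scale_left_distrib \<alpha>3[OF xyz] \<alpha>3[OF xyz(2,3,1)] \<alpha>3[OF xyz(3,1,2)]
      by (simp only: algebra_simps minus_add_distrib add_minus_cancel right_minus add_0_left)
    then show ?thesis using \<Phi>_jacobi \<open>v \<noteq> 0\<close> by simp
  qed
  then show ?thesis using rep by (simp add: two_cocycle_def projective_rep_def)
qed

section \<open>Projective equivalence gives cohomologous cocycles\<close>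

theorem lemma3p1:
  fixes G :: "('g, 'm) monoid_scheme"
    and sV :: "complex \<Rightarrow> 'v::ab_group_add \<Rightarrow> 'v" and BV :: "'v set"
    and sW :: "complex \<Rightarrow> 'w::ab_group_add \<Rightarrow> 'w" and BW :: "'w set"
    and \<alpha>\<^sub>1 \<alpha>\<^sub>2 :: "('g \<Rightarrow> complex) \<Rightarrow> ('g \<Rightarrow> complex) \<Rightarrow> complex"
    and \<Phi>\<^sub>1 :: "('g \<Rightarrow> complex) \<Rightarrow> 'v \<Rightarrow> 'v"
    and \<Phi>\<^sub>2 :: "('g \<Rightarrow> complex) \<Rightarrow> 'w \<Rightarrow> 'w"
  assumes "group G" and "finite (carrier G)"
    and "finite_dimensional_vector_space sV BV"
    and "finite_dimensional_vector_space sW BW"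
    and "\<exists>v::'v. v \<noteq> 0"
    and "projective_rep G sV \<alpha>\<^sub>1 \<Phi>\<^sub>1"
    and "projective_rep G sW \<alpha>\<^sub>2 \<Phi>\<^sub>2"
    and "projectively_equivalent G sV sW \<Phi>\<^sub>1 \<Phi>\<^sub>2"
  shows "cohomologous G \<alpha>\<^sub>1 \<alpha>\<^sub>2"
proof -
  interpret group G by fact
  \<comment> \<open>On the zero space any bilinear map is associated with the zero representation; a
    nonzero vector is what ties the cocycle to the representation. Its image \<open>f v\<close>
    serves the same purpose in the second space.\<close>
  obtain v :: 'v where v: "v \<noteq> 0" using assms(5) by blast
  from assms(8) obtain f \<delta> where f: "Vector_Spaces.linear sV sW f" "bij f"
    and \<delta>: "plesken_linear G (*) \<delta>"
    and eq: "\<And>x. x \<in> plesken G \<Longrightarrow>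
      \<Phi>\<^sub>2 x = (f \<circ> \<Phi>\<^sub>1 x \<circ> inv_into UNIV f) + (\<lambda>w. sW (\<delta> x) w)"
    unfolding projectively_equivalent_def by blast
  interpret f: Vector_Spaces.linear sV sW f by fact
  have inv_f: "inv_into UNIV f (f u) = u" for u
    using f(2) by (simp add: bij_is_inj)
  have fv: "f v \<noteq> 0"
    using v f(2) by (metis bij_is_inj f.zero injD)
  \<comment> \<open>Evaluating at vectors \<open>f u\<close> eliminates the inverse of
    \<open>f\<close> from the equivalence.\<close>
  have \<Phi>\<^sub>2_f: "\<Phi>\<^sub>2 x (f u) = f (\<Phi>\<^sub>1 x u) + sW (\<delta> x) (f u)" if "x \<in> plesken G" for x u
    by (simp add: eq[OF that] inv_f)
  have \<Phi>\<^sub>2_lin: "Vector_Spaces.linear sW sW (\<Phi>\<^sub>2 x)" if "x \<in> plesken G" for x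
    using assms(7) that by (simp add: projective_rep_def)
  have \<Phi>\<^sub>2_add: "\<Phi>\<^sub>2 x (u + w) = \<Phi>\<^sub>2 x u + \<Phi>\<^sub>2 x w"
    and \<Phi>\<^sub>2_scale: "\<Phi>\<^sub>2 x (sW c u) = sW c (\<Phi>\<^sub>2 x u)" if "x \<in> plesken G" for x u w c
    using \<Phi>\<^sub>2_lin[OF that] by (simp_all add: linear_iff_module_hom module_hom.add module_hom.scale)
  have "\<alpha>\<^sub>2 x y - \<alpha>\<^sub>1 x y = - \<delta> (ga_bracket G x y)"
    if xy: "x \<in> plesken G" "y \<in> plesken G" for x y
  proof -
    let ?b = "ga_bracket G x y"
    have b: "?b \<in> plesken G" by (rule ga_bracket_closed[OF assms(2) xy])
    have 1: "\<Phi>\<^sub>1 x (\<Phi>\<^sub>1 y v) - \<Phi>\<^sub>1 y (\<Phi>\<^sub>1 x v) = sV (\<alpha>\<^sub>1 x y) v + \<Phi>\<^sub>1 ?b v"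
      using assms(6) xy unfolding projective_rep_def by (metis gl_bracket_apply plus_fun_apply)
    have 2: "\<Phi>\<^sub>2 x (\<Phi>\<^sub>2 y (f v)) - \<Phi>\<^sub>2 y (\<Phi>\<^sub>2 x (f v)) = sW (\<alpha>\<^sub>2 x y) (f v) + \<Phi>\<^sub>2 ?b (f v)"
      using assms(7) xy unfolding projective_rep_def by (metis gl_bracket_apply plus_fun_apply)
    \<comment> \<open>Every term containing \<open>\<delta> x\<close> or \<open>\<delta> y\<close>
      occurs in both orders of composition, because scalars commute with all operators involved, and
      so drops out.\<close>
    have "\<Phi>\<^sub>2 x (\<Phi>\<^sub>2 y (f v)) - \<Phi>\<^sub>2 y (\<Phi>\<^sub>2 x (f v)) = f (\<Phi>\<^sub>1 x (\<Phi>\<^sub>1 y v) - \<Phi>\<^sub>1 y (\<Phi>\<^sub>1 x v))"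
      by (simp add: \<Phi>\<^sub>2_f \<Phi>\<^sub>2_add \<Phi>\<^sub>2_scale xy f.diff f.vs2.scale_right_distrib mult.commute)
    also have "\<dots> = sW (\<alpha>\<^sub>1 x y) (f v) + f (\<Phi>\<^sub>1 ?b v)"
      by (simp add: 1 f.add f.scale)
    \<comment> \<open>Expanding \<open>\<Phi>\<^sub>2 ?b (f v)\<close> yields the same
      \<open>f (\<Phi>\<^sub>1 ?b v)\<close> as on the right, plus the scalar
      \<open>\<delta> ?b\<close>; cancelling leaves an equation between multiples of
      \<open>f v\<close>.\<close>
    finally have "sW (\<alpha>\<^sub>2 x y + \<delta> ?b) (f v) = sW (\<alpha>\<^sub>1 x y) (f v)"
      unfolding 2 by (simp add: \<Phi>\<^sub>2_f[OF b] f.vs2.scale_left_distrib)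
    then have "\<alpha>\<^sub>2 x y + \<delta> ?b = \<alpha>\<^sub>1 x y"
      using fv by simp
    then show ?thesis by (simp add: algebra_simps)
  qed
  moreover have "two_cocycle G \<alpha>\<^sub>1"
    by (rule two_cocycle_projective_rep[OF assms(1,2) f.vs1.vector_space_axioms v assms(6)])
  moreover have "two_cocycle G \<alpha>\<^sub>2"
    by (rule two_cocycle_projective_rep[OF assms(1,2) f.vs2.vector_space_axioms fv assms(7)])
  ultimately show ?thesis
    using \<delta> unfolding cohomologous_def by blast
qed

end
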